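(* Let $A,B$ be complex $3\times3$ matrices with $\mathrm{Tr}(A)=\mathrm{Tr}(B)=0$ and $\mathrm{rank}([A,B]+I_3)=1$. Put $a_3=\mathrm{Tr}(A^2)$, $a_4=\mathrm{Tr}(AB)$, $a_5=\mathrm{Tr}(B^2)$, $a_6=\mathrm{Tr}(A^3)$, $a_7=\mathrm{Tr}(A^2B)$, $a_8=\mathrm{Tr}(AB^2)$, $a_9=\mathrm{Tr}(B^3)$. Then $$\begin{aligned} a_3a_9-2a_4a_8+a_5a_7&=0,\\ a_5a_6-2a_4a_7+a_3a_8&=0,\\ 9a_3-a_3a_4^2+a_3^2a_5+6a_6a_8-6a_7^2&=0,\\ 9a_4-a_4^3+a_3a_4a_5+3a_6a_9-3a_7a_8&=0,\\ 9a_5-a_4^2a_5+a_3a_5^2+6a_7a_9-6a_8^2&=0. \end{aligned}$$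
   Context: $[A,B]=AB-BA$ and $I_3$ is the $3\times3$ identity matrix. Such $(A,B)$ are the traceless pairs of matrices in the Calogero-Moser space $\mathcal{C}_3$. *)

theory Defs
  imports "HOL-Analysis.Analysis"
begin

(* On the type complex^3^3 the operations *, ^ and 1 are componentwise, so the matrix
   product, matrix powers and the identity matrix have to be written with ** and mat 1. *)

definition commutator :: "complex^3^3 \<Rightarrow> complex^3^3 \<Rightarrow> complex^3^3"
  where "commutator A B = A ** B - B ** A"

end

theory Submission
  imports Defs
begin

text \<open>
  Put $M = [A,B] + I$. Having rank one and trace 3, $M$ satisfies $M X M = \mathrm{Tr}(M X)\, M$ for
  every $X$; in particular $M^2 = 3M$ and $M A M = 0$. The traces of $M^2$, $M^2 A$ and $M A M A$
  involve words of degree up to six, which the polarised Cayley--Hamilton identity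
  $A^2 B + A B A + B A^2 = \frac{a_3}{2} B + a_4 A + a_7 I$ reduces to $a_3, \dots, a_9$ and
  $\mathrm{Tr}(A^2B^2)$. This gives the second and third equations. The commutator does not change
  when $A$ is replaced by $A \pm B$, and the three other equations are coefficients of the second
  and third ones polarised in this way.
\<close>

lemma matrix_sub_ldistrib:
  fixes X :: "'a::ring_1^'n^'m" and Y Z :: "'a^'k^'n"
  shows "X ** (Y - Z) = X ** Y - X ** Z"
  by (simp add: vec_eq_iff matrix_matrix_mult_def algebra_simps sum_subtractf)

lemma matrix_sub_rdistrib:
  fixes X Y :: "'a::ring_1^'n^'m" and Z :: "'a^'k^'n"
  shows "(X - Y) ** Z = X ** Z - Y ** Z"
  by (simp add: vec_eq_iff matrix_matrix_mult_def algebra_simps sum_subtractf)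

lemma matrix_add_rdistrib:
  fixes X Y :: "'a::semiring_1^'n^'m" and Z :: "'a^'k^'n"
  shows "(X + Y) ** Z = X ** Z + Y ** Z"
  by (simp add: vec_eq_iff matrix_matrix_mult_def algebra_simps sum.distrib)

lemma mat_mult_nth: "(mat c ** X) $ i $ j = c * X $ i $ j"
  for X :: "'a::comm_ring_1^'n^'n"
  by (simp add: matrix_matrix_mult_def mat_def if_distrib if_distribR sum.delta cong: if_cong)

lemma trace_mat_mult: "trace (mat c ** X) = c * trace X"
  for X :: "'a::comm_ring_1^'n^'n"
  by (simp add: trace_def mat_mult_nth sum_distrib_left)

lemmas matrix_distribs =
  matrix_add_ldistrib matrix_add_rdistrib matrix_sub_ldistrib matrix_sub_rdistrib

text \<open>The rows span a line, so all of them are multiples of one vector \<open>v\<close>; the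
  factors are the entries of \<open>u\<close>.\<close>

lemma rank_one_decomposition:
  fixes M :: "'a::field^'n^'m"
  assumes "rank M = 1"
  obtains u v where "\<And>i j. M $ i $ j = u $ i * v $ j"
proof -
  obtain b where b: "rows M \<subseteq> vec.span b" "card b = vec.dim (rows M)"
    using vec.basis_exists[of "rows M"] by metis
  with assms have "card b = 1"
    by (simp add: row_rank_def_gen)
  then obtain v where "b = {v}"
    by (auto simp: card_1_singleton_iff)
  with b have "row i M \<in> vec.span {v}" for i
    by (auto simp: rows_def)
  then have "\<exists>k. row i M = k *s v" for i
    by (auto simp: vec.span_singleton)
  then obtain k where k: "\<And>i. row i M = k i *s v"
    by metis
  have "M $ i $ j = (\<chi> i. k i) $ i * v $ j" for i j
    using k[of i] by (simp add: row_def vec_eq_iff)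
  then show thesis
    by (rule that)
qed

text \<open>For M = u v^T the middle of M X M collapses to the scalar v^T X u, which is the sum
  \<open>t\<close> and also the trace of M X.\<close>

lemma rank_one_sandwich:
  fixes M X :: "'a::field^'n^'n"
  assumes "rank M = 1"
  shows "M ** X ** M = mat (trace (M ** X)) ** M"
proof -
  obtain u v where M: "\<And>i j. M $ i $ j = u $ i * v $ j"
    using rank_one_decomposition[OF assms] by blast
  define t where "t = (\<Sum>k\<in>UNIV. \<Sum>l\<in>UNIV. v $ l * X $ l $ k * u $ k)"
  have "trace (M ** X) = t"
    by (simp add: trace_def matrix_matrix_mult_def M t_def mult_ac)
  moreover have "(M ** X ** M) $ i $ j = t * M $ i $ j" for i j
    by (simp add: matrix_matrix_mult_def M t_def sum_distrib_left sum_distrib_right mult_ac)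
  ultimately show ?thesis
    by (simp add: vec_eq_iff mat_mult_nth)
qed

text \<open>A traceless X satisfies X^3 = Tr(X^2)/2 X + Tr(X^3)/3 I. Putting X = A + tB and
  comparing the coefficients of t gives the identity. The check here is entrywise, with the (3,3)
  entries eliminated by tracelessness.\<close>

lemma cayley_hamilton_polarised_3:
  fixes A B :: "'a::field_char_0^3^3"
  assumes "trace A = 0" "trace B = 0"
  shows "A ** A ** B + A ** B ** A + B ** A ** A =
         mat (trace (A ** A) / 2) ** B + mat (trace (A ** B)) ** A + mat (trace (A ** A ** B))"
proof -
  have A: "A $ 3 $ 3 = - A $ 1 $ 1 - A $ 2 $ 2" and B: "B $ 3 $ 3 = - B $ 1 $ 1 - B $ 2 $ 2"
    using assms by (simp_all add: trace_def sum_3 algebra_simps eq_neg_iff_add_eq_0)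
  show ?thesis
    by (simp add: vec_eq_iff forall_3 mat_mult_nth)
       (simp add: mat_def trace_def matrix_matrix_mult_def sum_3 A B field_simps)
qed

text \<open>Six linear relations, three from Cayley-Hamilton and three from the rank condition,
  constrain the four auxiliary traces \<open>w\<close>, \<open>s\<close>, \<open>p\<close>,
  \<open>q\<close>; eliminating these leaves two equations.\<close>

lemma calogero_moser_trace_identities:
  fixes A B :: "complex^3^3"
  assumes A: "trace A = 0" and B: "trace B = 0"
    and rank: "rank (commutator A B + mat 1) = 1"
  shows "trace (B ** B) * trace (A ** A ** A) - 2 * trace (A ** B) * trace (A ** A ** B)
      + trace (A ** A) * trace (A ** B ** B) = 0" (is ?E2)
    and "9 * trace (A ** A) - trace (A ** A) * trace (A ** B)^2 + trace (A ** A)^2 * trace (B ** B)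
      + 6 * trace (A ** A ** A) * trace (A ** B ** B) - 6 * trace (A ** A ** B)^2 = 0" (is ?E3)
proof -
  define M where "M = commutator A B + mat 1"
  have M: "M = A ** B - B ** A + mat 1"
    by (simp add: M_def commutator_def)
  note expand = matrix_distribs matrix_mul_assoc trace_add trace_sub
  have cyc: "trace (X ** Y) = trace (Y ** X)" for X Y :: "complex^3^3"
    by (rule trace_mul_sym)
  define a3 a4 a5 a6 a7 a8 where "a3 = trace (A ** A)" and "a4 = trace (A ** B)"
    and "a5 = trace (B ** B)" and "a6 = trace (A ** A ** A)" and "a7 = trace (A ** A ** B)"
    and "a8 = trace (A ** B ** B)"
  note a_defs = a3_def a4_def a5_def a6_def a7_def a8_def
  \<comment> \<open>Two letters B among four, five or six letters give, up to rotation, the words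
    A^2B^2, ABAB; A^3B^2, A^2BAB; A^4B^2, A^3BAB, A^2BA^2B. Those containing A^3 reduce by
    Cayley-Hamilton; the other four get names.\<close>
  define w s p q where "w = trace (A ** A ** B ** B)" and "s = trace (A ** B ** A ** B)"
    and "p = trace (A ** A ** B ** A ** B)" and "q = trace (A ** A ** B ** A ** A ** B)"

  have sandwich: "M ** X ** M = mat (trace (M ** X)) ** M" for X
    using rank by (simp add: M_def rank_one_sandwich)
  have trM: "trace M = 3"
    by (simp add: M trace_add trace_sub cyc[of B A] trace_I)
  have trMA: "trace (M ** A) = 0"
    using cyc[of "B ** A" A] A by (simp add: M expand)
  have MM: "M ** M = mat 3 ** M"
    using sandwich[of "mat 1"] trM by simp
  have MAM: "M ** A ** M = mat 0 ** M"
    using sandwich[of A] trMA by simp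

  \<comment> \<open>The polarised identity at B = A, divided by three.\<close>
  have CH: "A ** A ** A = mat (a3 / 2) ** A + mat (a6 / 3)"
  proof -
    have "(A ** A ** A) $ i $ j = (mat (a3 / 2) ** A + mat (a6 / 3)) $ i $ j" for i j
      using arg_cong[OF cayley_hamilton_polarised_3[OF A A], of "\<lambda>X. X $ i $ j"]
      by (simp add: mat_mult_nth a_defs) (simp add: mat_def field_simps split: if_splits)
    then show ?thesis
      by (simp add: vec_eq_iff)
  qed
  have CH_trace: "trace (A ** A ** A ** X) = a3 / 2 * trace (A ** X) + a6 / 3 * trace X" for X
    unfolding CH by (simp add: expand trace_mat_mult flip: matrix_mul_assoc)
  have P_trace: "trace (A ** A ** B ** X) + trace (A ** B ** A ** X) + trace (B ** A ** A ** X) =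
      a3 / 2 * trace (B ** X) + a4 * trace (A ** X) + a7 * trace X" for X
    using arg_cong[OF cayley_hamilton_polarised_3[OF A B], of "\<lambda>Y. trace (Y ** X)"]
    by (simp add: matrix_distribs trace_add a_defs trace_mat_mult flip: matrix_mul_assoc)

  have s: "2 * w + s = a3 * a5 / 2 + a4^2"
    using P_trace[of B] cyc[of B "A ** A ** B"] B
    by (simp add: w_def s_def a_defs matrix_mul_assoc power2_eq_square)
  \<comment> \<open>Since Tr([A,B]) = 0, Tr(M^2) = Tr([A,B]^2) + 3. The left side is 3 Tr(M) = 9,
    and Tr([A,B]^2) = 2s - 2w.\<close>
  have "2 * s - 2 * w = 6"
  proof -
    have "trace (M ** M) = 9"
      by (simp add: MM trace_mat_mult trM)
    from this[unfolded M expand] show ?thesis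
      using cyc[of A "B ** B ** A"] cyc[of B "A ** A ** B"] cyc[of B "A ** B ** A"] cyc[of B A]
        cyc[of "B ** B" "A ** A"]
      by (simp add: w_def s_def trace_I matrix_mul_assoc)
  qed
  with s have sw: "s = w + 3" "3 * w + 3 = a3 * a5 / 2 + a4^2"
    by algebra+

  have AAAB: "trace (A ** A ** A ** B) = a3 * a4 / 2"
    using CH_trace[of B] B by (simp add: a_defs)
  have AAABB: "trace (A ** A ** A ** B ** B) = a3 / 2 * a8 + a6 / 3 * a5"
    using CH_trace[of "B ** B"] by (simp add: a_defs matrix_mul_assoc)
  have AAABAB: "trace (A ** A ** A ** B ** A ** B) = a3 / 2 * s + a6 / 3 * a8"
    using CH_trace[of "B ** A ** B"] cyc[of "B ** A" B] cyc[of "B ** B" A]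
    by (simp add: a_defs s_def matrix_mul_assoc)
  have AAAABB: "trace (A ** A ** A ** A ** B ** B) = a3 / 2 * w + a6 / 3 * a8"
    using CH_trace[of "A ** B ** B"] by (simp add: a_defs w_def matrix_mul_assoc)

  have p: "2 * p + (a3 / 2 * a8 + a6 / 3 * a5) = a3 / 2 * a8 + 2 * a4 * a7"
    using P_trace[of "A ** B"] cyc[of "B" "A ** A ** A ** B"] cyc[of "A ** B" "A ** A ** B"]
      cyc[of "B ** A" B] cyc[of "B ** B" A] AAABB
    by (simp add: a_defs p_def matrix_mul_assoc)
  \<comment> \<open>Expanding Tr(M^2 A) = 3 Tr(M A) = 0 leaves Tr([A,B]^2 A) = 0. Three of its four
    words rotate to \<open>p\<close>, with signs +, -, +, and the fourth to A^3B^2 with sign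
    -.\<close>
  have "p = trace (A ** A ** A ** B ** B)"
  proof -
    have "trace (M ** M ** A) = 0"
      by (simp add: MM trace_mat_mult trMA flip: matrix_mul_assoc)
    from this[unfolded M expand] show ?thesis
      using cyc[of "A ** B ** A ** B" A] cyc[of "A ** B ** B" "A ** A"] cyc[of "B ** A" "A ** B ** A"]
        cyc[of "B" "A ** B ** A ** A"] cyc[of "A ** B" "A ** A ** B"] cyc[of "A ** B" A]
        cyc[of B "A ** A"] A
      by (simp add: p_def matrix_mul_assoc)
  qed
  then have pA: "p - (a3 / 2 * a8 + a6 / 3 * a5) = 0"
    using AAABB by simp
  \<comment> \<open>The Cayley-Hamilton relation minus twice the rank relation, so that
    \<open>p\<close> cancels.\<close>
  have "a5 * a6 - 2 * a4 * a7 + a3 * a8 =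
      (2 * p + (a3 / 2 * a8 + a6 / 3 * a5) - (a3 / 2 * a8 + 2 * a4 * a7))
      - 2 * (p - (a3 / 2 * a8 + a6 / 3 * a5))"
    by (simp add: field_simps)
  also have "\<dots> = 0"
    unfolding p pA by simp
  finally have "a5 * a6 - 2 * a4 * a7 + a3 * a8 = 0" .
  then show ?E2
    by (simp add: a_defs)

  have q: "q + (a3 / 2 * s + a6 / 3 * a8) + (a3 / 2 * w + a6 / 3 * a8)
      = a3 / 2 * w + a4 * (a3 * a4 / 2) + a7^2"
    using P_trace[of "A ** A ** B"] AAAB AAABAB AAAABB cyc[of "A ** B" "A ** A ** A ** B"]
      cyc[of B "A ** A ** A ** A ** B"] cyc[of B "A ** A ** B"]
    by (simp add: q_def a_defs w_def matrix_mul_assoc power2_eq_square)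
  \<comment> \<open>In Tr(M A M A) = 0 the cross terms Tr([A,B] A^2) vanish, which leaves Tr([A,B] A
    [A,B] A) + Tr(A^2).\<close>
  have "2 * q - 2 * trace (A ** A ** A ** B ** A ** B) + a3 = 0"
  proof -
    have "trace (M ** A ** M ** A) = 0"
      unfolding MAM by (simp only: trace_mat_mult mult_zero_left flip: matrix_mul_assoc)
    from this[unfolded M expand] show ?thesis
      using cyc[of "A ** B ** A ** A ** B" A]
        cyc[of "A ** B" "A ** A ** A ** B"] cyc[of "B" "A ** A ** A ** B ** A"]
        cyc[of "B" "A ** A ** B ** A ** A"] cyc[of "A ** B ** A" A] cyc[of "A ** B" "A"]
        cyc[of "A ** B" "A ** A"] cyc[of "B" "A ** A ** A"]
        cyc[of "A ** B ** B ** A ** A" A] cyc[of "A ** B ** A ** B ** A" A]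
        cyc[of "A ** B ** B" "A ** A"]
        cyc[of "A ** B ** A ** B" "A ** A"]
      by (simp add: q_def a_defs matrix_mul_assoc)
  qed
  then have qA: "2 * q - 2 * (a3 / 2 * s + a6 / 3 * a8) + a3 = 0"
    by (simp only: AAABAB)
  \<comment> \<open>The multipliers 6, -3, -6 \<open>a3\<close> and -2 \<open>a3\<close> are those
    for which \<open>q\<close>, \<open>s\<close> and \<open>w\<close> cancel.\<close>
  have "9 * a3 - a3 * a4^2 + a3^2 * a5 + 6 * a6 * a8 - 6 * a7^2 =
      6 * (q + (a3 / 2 * s + a6 / 3 * a8) + (a3 / 2 * w + a6 / 3 * a8)
        - (a3 / 2 * w + a4 * (a3 * a4 / 2) + a7^2))
      - 3 * (2 * q - 2 * (a3 / 2 * s + a6 / 3 * a8) + a3)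
      - 6 * a3 * (s - (w + 3)) - 2 * a3 * (3 * w + 3 - (a3 * a5 / 2 + a4^2))"
    by (simp add: field_simps power2_eq_square)
  also have "\<dots> = 0"
    unfolding q qA sw(2) by (simp add: sw(1))
  finally have "9 * a3 - a3 * a4^2 + a3^2 * a5 + 6 * a6 * a8 - 6 * a7^2 = 0" .
  then show ?E3
    by (simp add: a_defs)
qed

theorem proposition3p2:
  fixes A B :: "complex^3^3"
    and a3 a4 a5 a6 a7 a8 a9 :: complex
  assumes "trace A = 0"
    and "trace B = 0"
    and "rank (commutator A B + mat 1) = 1"
    and "a3 = trace (A ** A)"
    and "a4 = trace (A ** B)"
    and "a5 = trace (B ** B)"
    and "a6 = trace (A ** A ** A)"
    and "a7 = trace (A ** A ** B)"
    and "a8 = trace (A ** B ** B)"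
    and "a9 = trace (B ** B ** B)"
  shows "a3 * a9 - 2 * a4 * a8 + a5 * a7 = 0 \<and>
         a5 * a6 - 2 * a4 * a7 + a3 * a8 = 0 \<and>
         9 * a3 - a3 * a4^2 + a3^2 * a5 + 6 * a6 * a8 - 6 * a7^2 = 0 \<and>
         9 * a4 - a4^3 + a3 * a4 * a5 + 3 * a6 * a9 - 3 * a7 * a8 = 0 \<and>
         9 * a5 - a4^2 * a5 + a3 * a5^2 + 6 * a7 * a9 - 6 * a8^2 = 0"
proof -
  have comm: "commutator (A + B) B = commutator A B" "commutator (A - B) B = commutator A B"
    by (simp_all add: commutator_def matrix_distribs)
  have tr: "trace (A + B) = 0" "trace (A - B) = 0"
    using assms(1,2) by (simp_all add: trace_add trace_sub)
  have cyc: "trace (X ** Y) = trace (Y ** X)" for X Y :: "complex^3^3"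
    by (rule trace_mul_sym)
  have words: "trace (B ** A) = a4" "trace (A ** B ** A) = a7" "trace (B ** A ** A) = a7"
    "trace (B ** A ** B) = a8" "trace (B ** B ** A) = a8"
    using assms cyc[of B A] cyc[of A "B ** A"] cyc[of B "A ** A"] cyc[of B "A ** B"] cyc[of "B ** B" A]
    by (simp_all add: matrix_mul_assoc)
  note simps = matrix_distribs matrix_mul_assoc trace_add trace_sub words
    assms(4-10)[symmetric]
  have plus: "trace ((A + B) ** (A + B)) = a3 + 2 * a4 + a5"
    "trace ((A + B) ** B) = a4 + a5"
    "trace ((A + B) ** (A + B) ** (A + B)) = a6 + 3 * a7 + 3 * a8 + a9"
    "trace ((A + B) ** (A + B) ** B) = a7 + 2 * a8 + a9"
    "trace ((A + B) ** B ** B) = a8 + a9"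
    by (simp_all add: simps)
  have minus: "trace ((A - B) ** (A - B)) = a3 - 2 * a4 + a5"
    "trace ((A - B) ** B) = a4 - a5"
    "trace ((A - B) ** (A - B) ** (A - B)) = a6 - 3 * a7 + 3 * a8 - a9"
    "trace ((A - B) ** (A - B) ** B) = a7 - 2 * a8 + a9"
    "trace ((A - B) ** B ** B) = a8 - a9"
    by (simp_all add: simps)
  have E2: "a5 * a6 - 2 * a4 * a7 + a3 * a8 = 0" (is "?p = 0")
    and E3: "9 * a3 - a3 * a4^2 + a3^2 * a5 + 6 * a6 * a8 - 6 * a7^2 = 0" (is "?q = 0")
    using calogero_moser_trace_identities[OF assms(1-3)] by (simp_all add: assms(4-10))
  have E2_plus: "a5 * (a6 + 3 * a7 + 3 * a8 + a9) - 2 * (a4 + a5) * (a7 + 2 * a8 + a9)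
        + (a3 + 2 * a4 + a5) * (a8 + a9) = 0" (is "?p1 = 0")
    and E3_plus: "9 * (a3 + 2 * a4 + a5) - (a3 + 2 * a4 + a5) * (a4 + a5)^2 + (a3 + 2 * a4 + a5)^2 * a5
        + 6 * (a6 + 3 * a7 + 3 * a8 + a9) * (a8 + a9)
        - 6 * (a7 + 2 * a8 + a9)^2 = 0" (is "?q1 = 0")
    using calogero_moser_trace_identities[of "A + B" B, unfolded comm(1), OF tr(1) assms(2,3)]
    by (simp_all only: plus assms(6)[symmetric])
  have E3_minus: "9 * (a3 - 2 * a4 + a5) - (a3 - 2 * a4 + a5) * (a4 - a5)^2 + (a3 - 2 * a4 + a5)^2 * a5
        + 6 * (a6 - 3 * a7 + 3 * a8 - a9) * (a8 - a9)
        - 6 * (a7 - 2 * a8 + a9)^2 = 0" (is "?q2 = 0")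
    using calogero_moser_trace_identities(2)[of "A - B" B, unfolded comm(2), OF tr(2) assms(2,3)]
    by (simp only: minus assms(6)[symmetric])
  \<comment> \<open>Replacing A by A + tB turns \<open>?p\<close> into \<open>?p\<close> plus t
    times the left side of the first equation: the terms in t^2 and t^3 cancel, so t = 1
    suffices.\<close>
  have "a3 * a9 - 2 * a4 * a8 + a5 * a7 = ?p1 - ?p"
    by (simp add: algebra_simps)
  also have "\<dots> = 0"
    by (simp only: E2 E2_plus diff_self)
  finally have 1: "a3 * a9 - 2 * a4 * a8 + a5 * a7 = 0" .
  \<comment> \<open>Replacing A by A + tB turns \<open>?q\<close> into \<open>?q\<close> + 2t x +
    t^2 y, where x and y are the left sides of the fourth and fifth equations. The values t = 1 and
    t = -1 separate x from y.\<close>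
  have "9 * a4 - a4^3 + a3 * a4 * a5 + 3 * a6 * a9 - 3 * a7 * a8 = (?q1 - ?q2) / 4"
    by (simp add: field_simps power2_eq_square power3_eq_cube)
  also have "\<dots> = 0"
    unfolding E3_plus E3_minus by simp
  finally have 4: "9 * a4 - a4^3 + a3 * a4 * a5 + 3 * a6 * a9 - 3 * a7 * a8 = 0" .
  have "9 * a5 - a4^2 * a5 + a3 * a5^2 + 6 * a7 * a9 - 6 * a8^2 = (?q1 + ?q2 - 2 * ?q) / 2"
    by (simp add: field_simps power2_eq_square)
  also have "\<dots> = 0"
    unfolding E3 E3_plus E3_minus by simp
  finally show ?thesis
    using 1 4 E2 E3 by blast
qed

end
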